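(* Let $H$ be a Hopf algebra over a field $\Bbbk$, and let $H_{\mathrm{ad\,fin}} = \{ h \in H \mid \dim_\Bbbk H.h < \infty\}$ be the locally finite part of the left adjoint representation of $H$. Then: (a) $H_{\mathrm{ad\,fin}}$ is always a left coideal subalgebra of $H$. (b) If $H$ is virtually cocommutative, then $H_{\mathrm{ad\,fin}}$ is a Hopf subalgebra of $H$.
   Context: $\Bbbk$ is an arbitrary field and $\otimes = \otimes_\Bbbk$. $H$ has comultiplication $\Delta h = h_{(1)} \otimes h_{(2)}$ (Sweedler notation), antipode $\mathsf{S}$ and counit $\varepsilon$. The left adjoint action of $H$ on itself is $k.h = k_{(1)}\, h\, \mathsf{S}(k_{(2)})$ for $h,k \in H$, and $H.h = \{k.h \mid k \in H\}$. A left coideal subalgebra of $H$ is a subalgebra $C \subseteq H$ with $\Delta(C) \subseteq H \otimes C$. $H$ is called virtually cocommutative if $H$ is finitely generated as a right module over some cocommutative Hopf subalgebra $K \subseteq H$. *)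

theory Defs
  imports Complex_Main "HOL-Library.Poly_Mapping"
begin

section \<open>Free vector spaces\<close>

text \<open>
  The type \<open>'p \<Rightarrow>\<^sub>0 'k\<close> of finitely supported functions is the vector space over \<open>'k\<close> with basis \<open>'p\<close>.
\<close>

definition free_scale :: "'k::field \<Rightarrow> ('p \<Rightarrow>\<^sub>0 'k) \<Rightarrow> ('p \<Rightarrow>\<^sub>0 'k)"
  where "free_scale c = Poly_Mapping.map ((*) c)"

definition gen :: "'p \<Rightarrow> ('p \<Rightarrow>\<^sub>0 'k::field)"
  where "gen p = Poly_Mapping.single p 1"

definition linext ::
    "('k::field \<Rightarrow> 'c \<Rightarrow> 'c) \<Rightarrow> ('p \<Rightarrow> 'c) \<Rightarrow> ('p \<Rightarrow>\<^sub>0 'k) \<Rightarrow> 'c::ab_group_add"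
  where "linext s f x = (\<Sum>p\<in>Poly_Mapping.keys x. s (Poly_Mapping.lookup x p) (f p))"

lemma lookup_free_scale [simp]:
  "Poly_Mapping.lookup (free_scale c x) p = c * Poly_Mapping.lookup x p"
  by (simp add: free_scale_def Poly_Mapping.map.rep_eq when_def)

lemma vector_space_free_scale: "vector_space (free_scale :: 'k::field \<Rightarrow> ('p \<Rightarrow>\<^sub>0 'k) \<Rightarrow> _)"
  by unfold_locales (auto intro!: poly_mapping_eqI simp: lookup_add algebra_simps)


section \<open>Tensor squares and tensor cubes\<close>

text \<open>
  Let \<open>s\<close> be the scalar multiplication of a vector space \<open>V\<close> over \<open>'k\<close> whose underlying set is the
  whole type \<open>'v\<close>. Then \<open>V \<otimes> V\<close> is the quotient of the free vector space on \<open>'v \<times> 'v\<close> by the subspace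
  \<open>tensor_rel2 s\<close>, and \<open>V \<otimes> V \<otimes> V\<close> is the quotient of the free vector space on \<open>'v \<times> 'v \<times> 'v\<close> by
  \<open>tensor_rel3 s\<close>. Tensors are the cosets of these subspaces.
\<close>

definition tensor_rel2 :: "('k::field \<Rightarrow> 'v \<Rightarrow> 'v::ab_group_add) \<Rightarrow> ('v \<times> 'v \<Rightarrow>\<^sub>0 'k) set"
  where "tensor_rel2 s = module.span free_scale
    ({gen (a + a', b) - gen (a, b) - gen (a', b) | a a' b. True} \<union>
     {gen (a, b + b') - gen (a, b) - gen (a, b') | a b b'. True} \<union>
     {gen (s c a, b) - free_scale c (gen (a, b)) | c a b. True} \<union>
     {gen (a, s c b) - free_scale c (gen (a, b)) | c a b. True})"

definition tensor_rel3 :: "('k::field \<Rightarrow> 'v \<Rightarrow> 'v::ab_group_add) \<Rightarrow> ('v \<times> 'v \<times> 'v \<Rightarrow>\<^sub>0 'k) set"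
  where "tensor_rel3 s = module.span free_scale
    ({gen (a + a', b, d) - gen (a, b, d) - gen (a', b, d) | a a' b d. True} \<union>
     {gen (a, b + b', d) - gen (a, b, d) - gen (a, b', d) | a b b' d. True} \<union>
     {gen (a, b, d + d') - gen (a, b, d) - gen (a, b, d') | a b d d'. True} \<union>
     {gen (s c a, b, d) - free_scale c (gen (a, b, d)) | c a b d. True} \<union>
     {gen (a, s c b, d) - free_scale c (gen (a, b, d)) | c a b d. True} \<union>
     {gen (a, b, s c d) - free_scale c (gen (a, b, d)) | c a b d. True})"

definition tensor2 :: "('k::field \<Rightarrow> 'v \<Rightarrow> 'v::ab_group_add) \<Rightarrow> ('v \<times> 'v \<Rightarrow>\<^sub>0 'k) \<Rightarrow> ('v \<times> 'v \<Rightarrow>\<^sub>0 'k) set"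
  where "tensor2 s x = {y. y - x \<in> tensor_rel2 s}"

definition tensor3 ::
    "('k::field \<Rightarrow> 'v \<Rightarrow> 'v::ab_group_add) \<Rightarrow> ('v \<times> 'v \<times> 'v \<Rightarrow>\<^sub>0 'k) \<Rightarrow> ('v \<times> 'v \<times> 'v \<Rightarrow>\<^sub>0 'k) set"
  where "tensor3 s x = {y. y - x \<in> tensor_rel3 s}"

text \<open>
  For subspaces \<open>A\<close> and \<open>B\<close> of \<open>V\<close>, \<open>tensor_of s A B\<close> is \<open>A \<otimes> B\<close>, embedded in \<open>V \<otimes> V\<close> in the usual way.
\<close>

definition tensor_of ::
    "('k::field \<Rightarrow> 'v \<Rightarrow> 'v::ab_group_add) \<Rightarrow> 'v set \<Rightarrow> 'v set \<Rightarrow> ('v \<times> 'v \<Rightarrow>\<^sub>0 'k) set set"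
  where "tensor_of s A B = {tensor2 s x | x. Poly_Mapping.keys x \<subseteq> A \<times> B}"

text \<open>
  Operations on tensors are computed on a representative \<open>\<Sum>\<^sub>i c\<^sub>i (a\<^sub>i, b\<^sub>i)\<close>; the result does not
  depend on its choice, since the maps involved are (multi)linear.
\<close>

definition rep :: "'x set \<Rightarrow> 'x"
  where "rep t = (SOME x. x \<in> t)"

definition tensor_add ::
    "('k::field \<Rightarrow> 'v \<Rightarrow> 'v::ab_group_add) \<Rightarrow>
      ('v \<times> 'v \<Rightarrow>\<^sub>0 'k) set \<Rightarrow> ('v \<times> 'v \<Rightarrow>\<^sub>0 'k) set \<Rightarrow> ('v \<times> 'v \<Rightarrow>\<^sub>0 'k) set"
  where "tensor_add s t u = tensor2 s (rep t + rep u)"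

definition tensor_scale ::
    "('k::field \<Rightarrow> 'v \<Rightarrow> 'v::ab_group_add) \<Rightarrow> 'k \<Rightarrow> ('v \<times> 'v \<Rightarrow>\<^sub>0 'k) set \<Rightarrow> ('v \<times> 'v \<Rightarrow>\<^sub>0 'k) set"
  where "tensor_scale s c t = tensor2 s (free_scale c (rep t))"

definition tensor_mult ::
    "('k::field \<Rightarrow> 'v \<Rightarrow> 'v::ring_1) \<Rightarrow>
      ('v \<times> 'v \<Rightarrow>\<^sub>0 'k) set \<Rightarrow> ('v \<times> 'v \<Rightarrow>\<^sub>0 'k) set \<Rightarrow> ('v \<times> 'v \<Rightarrow>\<^sub>0 'k) set"
  where "tensor_mult s t u = tensor2 s
    (linext free_scale (\<lambda>(a, b). linext free_scale (\<lambda>(a', b'). gen (a * a', b * b')) (rep u)) (rep t))"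

definition tensor_flip ::
    "('k::field \<Rightarrow> 'v \<Rightarrow> 'v::ab_group_add) \<Rightarrow> ('v \<times> 'v \<Rightarrow>\<^sub>0 'k) set \<Rightarrow> ('v \<times> 'v \<Rightarrow>\<^sub>0 'k) set"
  where "tensor_flip s t = tensor2 s (linext free_scale (\<lambda>(a, b). gen (b, a)) (rep t))"

text \<open>
  For a bilinear map \<open>f\<close> from \<open>V \<times> V\<close> to a vector space with scalar multiplication \<open>s'\<close>,
  \<open>tensor_eval s' f\<close> is the induced linear map on \<open>V \<otimes> V\<close>.
\<close>

definition tensor_eval ::
    "('k::field \<Rightarrow> 'w \<Rightarrow> 'w) \<Rightarrow> ('v \<Rightarrow> 'v \<Rightarrow> 'w) \<Rightarrow> ('v \<times> 'v \<Rightarrow>\<^sub>0 'k) set \<Rightarrow> 'w::ab_group_add"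
  where "tensor_eval s' f t = linext s' (\<lambda>(a, b). f a b) (rep t)"

text \<open>
  For a linear map \<open>D\<close> from \<open>V\<close> to \<open>V \<otimes> V\<close>, these are \<open>D \<otimes> id\<close> and \<open>id \<otimes> D\<close>, both with
  values in \<open>V \<otimes> V \<otimes> V\<close>.
\<close>

definition tensor_map_left ::
    "('k::field \<Rightarrow> 'v \<Rightarrow> 'v::ab_group_add) \<Rightarrow> ('v \<Rightarrow> ('v \<times> 'v \<Rightarrow>\<^sub>0 'k) set) \<Rightarrow>
      ('v \<times> 'v \<Rightarrow>\<^sub>0 'k) set \<Rightarrow> ('v \<times> 'v \<times> 'v \<Rightarrow>\<^sub>0 'k) set"
  where "tensor_map_left s D t = tensor3 s
    (linext free_scale (\<lambda>(a, b). linext free_scale (\<lambda>(p, q). gen (p, q, b)) (rep (D a))) (rep t))"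

definition tensor_map_right ::
    "('k::field \<Rightarrow> 'v \<Rightarrow> 'v::ab_group_add) \<Rightarrow> ('v \<Rightarrow> ('v \<times> 'v \<Rightarrow>\<^sub>0 'k) set) \<Rightarrow>
      ('v \<times> 'v \<Rightarrow>\<^sub>0 'k) set \<Rightarrow> ('v \<times> 'v \<times> 'v \<Rightarrow>\<^sub>0 'k) set"
  where "tensor_map_right s D t = tensor3 s
    (linext free_scale (\<lambda>(a, b). linext free_scale (\<lambda>(p, q). gen (a, p, q)) (rep (D b))) (rep t))"


section \<open>Hopf algebras\<close>

text \<open>
  The class \<open>ring_1\<close> includes \<open>0 \<noteq> 1\<close>, which holds in every Hopf algebra because the counit maps \<open>1\<close> to \<open>1\<close>.
\<close>

locale k_algebra = vector_space scale
  for scale :: "'k::field \<Rightarrow> 'h::ring_1 \<Rightarrow> 'h" +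
  assumes scale_mult_left: "scale c a * b = scale c (a * b)"
    and scale_mult_right: "a * scale c b = scale c (a * b)"

locale k_coalgebra = vector_space scale
  for scale :: "'k::field \<Rightarrow> 'h::ab_group_add \<Rightarrow> 'h" +
  fixes comult :: "'h \<Rightarrow> ('h \<times> 'h \<Rightarrow>\<^sub>0 'k) set"
    and counit :: "'h \<Rightarrow> 'k"
  assumes comult_tensor: "comult h \<in> tensor_of scale UNIV UNIV"
    and comult_add: "comult (g + h) = tensor_add scale (comult g) (comult h)"
    and comult_scale: "comult (scale c h) = tensor_scale scale c (comult h)"
    and counit_linear: "Vector_Spaces.linear scale (*) counit"
    and coassoc: "tensor_map_left scale comult (comult h) = tensor_map_right scale comult (comult h)"
    and counit_left: "tensor_eval scale (\<lambda>a b. scale (counit a) b) (comult h) = h"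
    and counit_right: "tensor_eval scale (\<lambda>a b. scale (counit b) a) (comult h) = h"

locale hopf_algebra = k_algebra scale + k_coalgebra scale comult counit
  for scale :: "'k::field \<Rightarrow> 'h::ring_1 \<Rightarrow> 'h"
    and comult :: "'h \<Rightarrow> ('h \<times> 'h \<Rightarrow>\<^sub>0 'k) set"
    and counit :: "'h \<Rightarrow> 'k" +
  fixes antipode :: "'h \<Rightarrow> 'h"
  assumes comult_mult: "comult (g * h) = tensor_mult scale (comult g) (comult h)"
    and comult_one: "comult 1 = tensor2 scale (gen (1, 1))"
    and counit_mult: "counit (g * h) = counit g * counit h"
    and counit_one: "counit 1 = 1"
    and antipode_linear: "Vector_Spaces.linear scale scale antipode"
    and antipode_left: "tensor_eval scale (\<lambda>a b. antipode a * b) (comult h) = scale (counit h) 1"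
    and antipode_right: "tensor_eval scale (\<lambda>a b. a * antipode b) (comult h) = scale (counit h) 1"
begin

definition ad :: "'h \<Rightarrow> 'h \<Rightarrow> 'h"
  where "ad k h = tensor_eval scale (\<lambda>a b. a * h * antipode b) (comult k)"

definition ad_orbit :: "'h \<Rightarrow> 'h set"
  where "ad_orbit h = {ad k h | k. True}"

definition finite_dim :: "'h set \<Rightarrow> bool"
  where "finite_dim V \<longleftrightarrow> (\<exists>B. finite B \<and> span B = V)"

definition ad_fin :: "'h set"
  where "ad_fin = {h. finite_dim (ad_orbit h)}"

definition subalgebra :: "'h set \<Rightarrow> bool"
  where "subalgebra C \<longleftrightarrow> subspace C \<and> 1 \<in> C \<and> (\<forall>a\<in>C. \<forall>b\<in>C. a * b \<in> C)"

definition left_coideal_subalgebra :: "'h set \<Rightarrow> bool"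
  where "left_coideal_subalgebra C \<longleftrightarrow>
    subalgebra C \<and> (\<forall>h\<in>C. comult h \<in> tensor_of scale UNIV C)"

definition hopf_subalgebra :: "'h set \<Rightarrow> bool"
  where "hopf_subalgebra K \<longleftrightarrow>
    subalgebra K \<and> (\<forall>h\<in>K. comult h \<in> tensor_of scale K K) \<and> (\<forall>h\<in>K. antipode h \<in> K)"

text \<open>
  Since \<open>K \<otimes> K\<close> embeds in \<open>H \<otimes> H\<close> for a subspace \<open>K\<close> of \<open>H\<close>, cocommutativity of a Hopf subalgebra \<open>K\<close>
  can be read off in \<open>H \<otimes> H\<close>.
\<close>

definition cocommutative_on :: "'h set \<Rightarrow> bool"
  where "cocommutative_on K \<longleftrightarrow> (\<forall>h\<in>K. tensor_flip scale (comult h) = comult h)"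

definition fin_gen_right_module :: "'h set \<Rightarrow> bool"
  where "fin_gen_right_module K \<longleftrightarrow>
    (\<exists>X. finite X \<and> (\<forall>h. \<exists>c. (\<forall>x\<in>X. c x \<in> K) \<and> h = (\<Sum>x\<in>X. x * c x)))"

definition virtually_cocommutative :: bool
  where "virtually_cocommutative \<longleftrightarrow>
    (\<exists>K. hopf_subalgebra K \<and> cocommutative_on K \<and> fin_gen_right_module K)"

end

end

theory Submission
  imports Defs
begin

text \<open>
  Let \<open>C\<close> be the locally finite part. It is a subalgebra because \<open>k.(ab) = (k\<^sub>1.a)(k\<^sub>2.b)\<close>. From
  \<open>\<Delta>(k.h) = k\<^sub>1 h\<^sub>1 S(k\<^sub>4) \<otimes> k\<^sub>2 h\<^sub>2 S(k\<^sub>3)\<close> one gets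
  \<open>h\<^sub>1 \<otimes> k.h\<^sub>2 = S(k\<^sub>1) (k\<^sub>2.h)\<^sub>1 k\<^sub>3 \<otimes> (k\<^sub>2.h)\<^sub>2\<close>, so the right legs of \<open>\<Delta>(H.h)\<close> span a space that contains
  all \<open>\<phi>(h\<^sub>1) k.h\<^sub>2\<close>; hence \<open>\<Delta>(C) \<subseteq> H \<otimes> C\<close>.

  If \<open>H = \<Sum>\<^sub>i x\<^sub>i K\<close> is a finite sum with \<open>K\<close> cocommutative, then \<open>h \<in> C\<close> as soon as \<open>K.h\<close> is finite-dimensional. For
  \<open>k \<in> K\<close> the factors of \<open>k\<close> in \<open>\<Delta>(k.h)\<close> may be permuted, so the mirrored identity
  \<open>k.h\<^sub>1 \<otimes> h\<^sub>2 = (k\<^sub>2.h)\<^sub>1 \<otimes> S(k\<^sub>1) (k\<^sub>2.h)\<^sub>2 k\<^sub>3\<close> holds and \<open>\<Delta>(C) \<subseteq> C \<otimes> H\<close>. Finally \<open>S\<^sup>2 = id\<close> on \<open>K\<close> yields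
  \<open>S(k.h) = k.S(h)\<close>, hence \<open>S(C) \<subseteq> C\<close>.
\<close>

section \<open>Linear extensions\<close>

lemma linear_compose_rule:
  assumes "Vector_Spaces.linear s1 s2 f" "Vector_Spaces.linear s2 s3 g"
  shows "Vector_Spaces.linear s1 s3 (\<lambda>x. g (f x))"
  using Vector_Spaces.linear_compose[OF assms] by (simp add: o_def)

lemma linext_superset:
  fixes x :: "'p \<Rightarrow>\<^sub>0 'k::field"
  assumes "vector_space s" "finite A" "Poly_Mapping.keys x \<subseteq> A"
  shows "linext s f x = (\<Sum>p\<in>A. s (Poly_Mapping.lookup x p) (f p))"
proof -
  interpret vector_space s by fact
  show ?thesis
    unfolding linext_def using assms
    by (intro sum.mono_neutral_left) (auto simp: in_keys_iff)
qed

lemma linear_linext: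
  fixes s :: "'k::field \<Rightarrow> 'c::ab_group_add \<Rightarrow> 'c" and f :: "'p \<Rightarrow> 'c"
  assumes "vector_space s"
  shows "Vector_Spaces.linear free_scale s (linext s f)"
proof -
  interpret s: vector_space s by fact
  interpret f: vector_space free_scale by (rule vector_space_free_scale)
  show ?thesis
  proof
    fix x y :: "'p \<Rightarrow>\<^sub>0 'k"
    \<comment> \<open>The supports of \<open>x\<close>, \<open>y\<close> and \<open>x + y\<close>
      may differ, so all three sums are taken over a common finite index set.\<close>
    let ?A = "Poly_Mapping.keys x \<union> Poly_Mapping.keys y"
    have "linext s f (x + y) = (\<Sum>p\<in>?A. s (Poly_Mapping.lookup (x + y) p) (f p))"
      using keys_add[of x y] by (intro linext_superset[OF assms]) auto
    moreover have "linext s f x = (\<Sum>p\<in>?A. s (Poly_Mapping.lookup x p) (f p))"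
      by (intro linext_superset[OF assms]) auto
    moreover have "linext s f y = (\<Sum>p\<in>?A. s (Poly_Mapping.lookup y p) (f p))"
      by (intro linext_superset[OF assms]) auto
    ultimately show "linext s f (x + y) = linext s f x + linext s f y"
      by (simp add: lookup_add s.scale_left_distrib sum.distrib)
  next
    fix c and x :: "'p \<Rightarrow>\<^sub>0 'k"
    have "Poly_Mapping.keys (free_scale c x) \<subseteq> Poly_Mapping.keys x"
      by (auto simp: in_keys_iff)
    then have "linext s f (free_scale c x)
        = (\<Sum>p\<in>Poly_Mapping.keys x. s (Poly_Mapping.lookup (free_scale c x) p) (f p))"
      by (intro linext_superset[OF assms]) auto
    then show "linext s f (free_scale c x) = s c (linext s f x)"
      by (simp add: linext_def s.scale_sum_right)
  qed
qed

lemma linext_gen [simp]: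
  assumes "vector_space s"
  shows "linext s f (gen p) = f p"
proof -
  interpret vector_space s by fact
  show ?thesis by (simp add: linext_def gen_def)
qed

lemma linear_linext_commute:
  assumes "Vector_Spaces.linear s1 s2 g"
  shows "g (linext s1 f x) = linext s2 (\<lambda>p. g (f p)) x"
proof -
  interpret Vector_Spaces.linear s1 s2 g by fact
  show ?thesis by (simp add: linext_def sum scale)
qed

lemma linext_gen_self: "linext free_scale gen x = x"
proof (rule poly_mapping_eqI)
  fix p
  have "Poly_Mapping.lookup (linext free_scale gen x) p
      = (\<Sum>q\<in>Poly_Mapping.keys x. Poly_Mapping.lookup x q * Poly_Mapping.lookup (gen q) p)"
    by (simp add: linext_def lookup_sum)
  also have "\<dots> = (\<Sum>q\<in>Poly_Mapping.keys x. if q = p then Poly_Mapping.lookup x p else 0)"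
    by (intro sum.cong) (auto simp: gen_def lookup_single when_def)
  also have "\<dots> = Poly_Mapping.lookup x p"
    by (simp add: in_keys_iff)
  finally show "Poly_Mapping.lookup (linext free_scale gen x) p = Poly_Mapping.lookup x p" .
qed

lemma linear_zero_on_span:
  assumes "Vector_Spaces.linear s1 s2 g" "x \<in> module.span s1 A" "\<And>y. y \<in> A \<Longrightarrow> g y = 0"
  shows "g x = 0"
proof -
  interpret Vector_Spaces.linear s1 s2 g by fact
  show ?thesis using assms(2,3) eq_0_on_span by blast
qed


section \<open>Multilinear maps on tensors\<close>

definition bilinear_maps where
  "bilinear_maps s s' f \<longleftrightarrow>
    (\<forall>b. Vector_Spaces.linear s s' (\<lambda>a. f a b)) \<and> (\<forall>a. Vector_Spaces.linear s s' (\<lambda>b. f a b))"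

lemma bilinear_mapsI:
  assumes "\<And>b. Vector_Spaces.linear s s' (\<lambda>a. f a b)"
    and "\<And>a. Vector_Spaces.linear s s' (\<lambda>b. f a b)"
  shows "bilinear_maps s s' f"
  using assms by (simp add: bilinear_maps_def)

lemma tensor2_self: "x \<in> tensor2 s x"
proof -
  interpret f: vector_space free_scale by (rule vector_space_free_scale)
  show ?thesis by (simp add: tensor2_def tensor_rel2_def f.span_zero)
qed

lemma tensor3_self: "x \<in> tensor3 s x"
proof -
  interpret f: vector_space free_scale by (rule vector_space_free_scale)
  show ?thesis by (simp add: tensor3_def tensor_rel3_def f.span_zero)
qed

lemma tensor2_eqI:
  assumes "x - y \<in> tensor_rel2 s"
  shows "tensor2 s x = tensor2 s y"
proof -
  interpret f: vector_space free_scale by (rule vector_space_free_scale)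
  have "z - x \<in> tensor_rel2 s \<longleftrightarrow> z - y \<in> tensor_rel2 s" for z
  proof
    assume "z - x \<in> tensor_rel2 s"
    from f.span_add[OF this[unfolded tensor_rel2_def] assms[unfolded tensor_rel2_def]]
    show "z - y \<in> tensor_rel2 s" by (simp add: tensor_rel2_def)
  next
    assume "z - y \<in> tensor_rel2 s"
    from f.span_diff[OF this[unfolded tensor_rel2_def] assms[unfolded tensor_rel2_def]]
    show "z - x \<in> tensor_rel2 s" by (simp add: tensor_rel2_def)
  qed
  then show ?thesis by (simp add: tensor2_def)
qed

text \<open>The linear extension of a bilinear map kills the four families that span
  \<open>tensor_rel2 s\<close>, hence the difference of any two representatives. This is the
  universal property of the tensor square.\<close>

lemma linext_tensor2_cong:
  assumes f: "bilinear_maps s s' f" and eq: "tensor2 s x = tensor2 s y"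
  shows "linext s' (\<lambda>(a, b). f a b) x = linext s' (\<lambda>(a, b). f a b) y"
proof -
  have l1: "Vector_Spaces.linear s s' (\<lambda>a. f a b)"
    and l2: "Vector_Spaces.linear s s' (\<lambda>b. f a b)" for a b
    using f by (auto simp: bilinear_maps_def)
  interpret s': vector_space s' using l1[of undefined] by (simp add: Vector_Spaces.linear_iff)
  let ?L = "linext s' (\<lambda>(a, b). f a b)"
  interpret L: Vector_Spaces.linear free_scale s' ?L by (rule linear_linext) unfold_locales
  have v: "vector_space s'" ..
  have "x - y \<in> tensor_rel2 s"
    using tensor2_self[of x s] unfolding eq by (simp add: tensor2_def)
  then have "?L (x - y) = 0"
    unfolding tensor_rel2_def
    by (rule linear_zero_on_span[OF L.linear_axioms])
      (use l1 l2 in \<open>auto simp: L.diff L.scale linext_gen[OF v] Vector_Spaces.linear_iff\<close>)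
  then show ?thesis by (simp add: L.diff)
qed

text \<open>The same argument for the six families that span \<open>tensor_rel3 s\<close>; it lets
  coassociativity be tested on trilinear maps.\<close>

lemma linext_tensor3_cong:
  assumes t: "\<And>b d. Vector_Spaces.linear s s' (\<lambda>a. t a b d)"
      "\<And>a d. Vector_Spaces.linear s s' (\<lambda>b. t a b d)"
      "\<And>a b. Vector_Spaces.linear s s' (\<lambda>d. t a b d)"
    and eq: "tensor3 s x = tensor3 s y"
  shows "linext s' (\<lambda>(a, b, d). t a b d) x = linext s' (\<lambda>(a, b, d). t a b d) y"
proof -
  interpret s': vector_space s' using t(1)[of undefined] by (simp add: Vector_Spaces.linear_iff)
  let ?L = "linext s' (\<lambda>(a, b, d). t a b d)"
  interpret L: Vector_Spaces.linear free_scale s' ?L by (rule linear_linext) unfold_locales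
  have v: "vector_space s'" ..
  have "x - y \<in> tensor_rel3 s"
    using tensor3_self[of x s] unfolding eq by (simp add: tensor3_def)
  then have "?L (x - y) = 0"
    unfolding tensor_rel3_def
    by (rule linear_zero_on_span[OF L.linear_axioms])
      (use t in \<open>auto simp: L.diff L.scale linext_gen[OF v] Vector_Spaces.linear_iff\<close>)
  then show ?thesis by (simp add: L.diff)
qed

lemma rep_tensor2: "tensor2 s (rep (tensor2 s x)) = tensor2 s x"
proof -
  have "rep (tensor2 s x) \<in> tensor2 s x"
    unfolding rep_def by (rule someI[of _ x]) (rule tensor2_self)
  then show ?thesis
    by (intro tensor2_eqI) (simp add: tensor2_def)
qed

lemma tensor_eval_tensor2:
  assumes "bilinear_maps s s' f"
  shows "tensor_eval s' f (tensor2 s x) = linext s' (\<lambda>(a, b). f a b) x"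
  unfolding tensor_eval_def by (rule linext_tensor2_cong[OF assms rep_tensor2])


section \<open>Membership in \<open>tensor_of\<close> from slices\<close>

lemma tensor_of_linear_combination:
  fixes s :: "'k::field \<Rightarrow> 'v \<Rightarrow> 'v::ab_group_add" and g :: "'v \<Rightarrow> ('p \<Rightarrow>\<^sub>0 'k)"
  assumes "vector_space s" and R: "module.subspace free_scale R"
    and add: "\<And>a b. g (a + b) - g a - g b \<in> R"
    and scale: "\<And>c a. g (s c a) - free_scale c (g a) \<in> R"
  shows "g (\<Sum>i\<in>I. s (c i) (f i)) - (\<Sum>i\<in>I. free_scale (c i) (g (f i))) \<in> R"
proof -
  interpret s: vector_space s by fact
  interpret f: vector_space "free_scale :: 'k \<Rightarrow> ('p \<Rightarrow>\<^sub>0 'k) \<Rightarrow> _" by (rule vector_space_free_scale)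
  \<comment> \<open>Covers the empty sum, and also an infinite \<open>I\<close>, over which sums are
    0 by convention.\<close>
  have zero: "g 0 \<in> R" using scale[of 0 0] by simp
  show ?thesis
  proof (induction I rule: infinite_finite_induct)
    case (insert i I)
    let ?a = "s (c i) (f i)" and ?b = "\<Sum>i\<in>I. s (c i) (f i)"
    have "(g (?a + ?b) - g ?a - g ?b) + (g ?a - free_scale (c i) (g (f i)))
        + (g ?b - (\<Sum>i\<in>I. free_scale (c i) (g (f i)))) \<in> R"
      by (intro f.subspace_add[OF R] add scale insert.IH)
    with insert.hyps show ?case by (simp add: algebra_simps)
  qed (simp_all add: zero)
qed

text \<open>
  Expanding the right legs of \<open>x\<close> in a basis of \<open>V\<close> that contains a basis of \<open>C\<close> writes the tensor as
  \<open>\<Sum>\<^sub>e x\<^sub>e \<otimes> e\<close>; each \<open>x\<^sub>e\<close> is a slice of \<open>x\<close>, and it vanishes unless \<open>e \<in> C\<close>.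
\<close>

lemma tensor2_in_tensor_ofI:
  fixes s :: "'k::field \<Rightarrow> 'v \<Rightarrow> 'v::ab_group_add"
  assumes "vector_space s"
    and right: "\<And>\<phi>. Vector_Spaces.linear s (*) \<phi> \<Longrightarrow> linext s (\<lambda>(a, b). s (\<phi> a) b) x \<in> C"
    and left: "\<And>\<phi>. Vector_Spaces.linear s (*) \<phi> \<Longrightarrow> linext s (\<lambda>(a, b). s (\<phi> b) a) x \<in> D"
  shows "tensor2 s x \<in> tensor_of s D C"
proof -
  interpret s: vector_space s by fact
  interpret f: vector_space "free_scale :: 'k \<Rightarrow> ('v \<times> 'v \<Rightarrow>\<^sub>0 'k) \<Rightarrow> _" by (rule vector_space_free_scale)
  let ?R = "tensor_rel2 s"
  have R: "f.subspace ?R" by (simp add: tensor_rel2_def)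
  have rel: "gen (a + a', b) - gen (a, b) - gen (a', b) \<in> ?R"
    "gen (a, b + b') - gen (a, b) - gen (a, b') \<in> ?R"
    "gen (s c a, b) - free_scale c (gen (a, b)) \<in> ?R"
    "gen (a, s c b) - free_scale c (gen (a, b)) \<in> ?R" for a a' b b' c
    unfolding tensor_rel2_def by (rule f.span_base, blast)+
  obtain E where E: "E \<subseteq> C" "s.independent E" "C \<subseteq> s.span E"
    using s.basis_exists by metis
  define B where "B = s.extend_basis E"
  have B: "E \<subseteq> B" "s.independent B" "s.span B = UNIV"
    using s.extend_basis_superset[OF E(2)] s.independent_extend_basis[OF E(2)]
      s.span_extend_basis[OF E(2)] by (auto simp: B_def)
  let ?r = "\<lambda>e v. s.representation B v e"
  have r: "Vector_Spaces.linear s (*) (?r e)" for e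
    using B by (intro s.linear_representation) auto
  have r_scale: "?r e (s c v) = c * ?r e v" for e c v
    using r[of e] by (simp add: Vector_Spaces.linear_iff)
  let ?K = "Poly_Mapping.keys x" and ?c = "Poly_Mapping.lookup x"
  define slice where "slice e = linext s (\<lambda>(a, b). s (?r e b) a) x" for e
  have slice_sum: "slice e = (\<Sum>p\<in>?K. s (?c p * ?r e (snd p)) (fst p))" for e
    by (simp add: slice_def linext_def case_prod_beta)
  \<comment> \<open>The \<open>b\<close>-coordinate of the left slice at \<open>e\<close> equals the
    \<open>e\<close>-coordinate of the right slice at \<open>b\<close>. The latter slice lies in
    \<open>C\<close>, so its expansion uses only basis vectors from \<open>E\<close>.\<close>
  have slice_eq_0: "slice e = 0" if "e \<notin> E" for e
  proof -
    have "?r b (slice e) = 0" for b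
    proof -
      have "?r b (slice e) = (\<Sum>p\<in>?K. ?c p * (?r e (snd p) * ?r b (fst p)))"
        unfolding slice_def linear_linext_commute[OF r[of b]]
        by (simp only: linext_def case_prod_beta r_scale)
      also have "\<dots> = ?r e (linext s (\<lambda>(a, b'). s (?r b a) b') x)"
        unfolding linear_linext_commute[OF r[of e]]
        by (simp only: linext_def case_prod_beta r_scale mult.commute)
      also have "\<dots> = 0"
      proof -
        let ?v = "linext s (\<lambda>(a, b'). s (?r b a) b') x"
        have "?v \<in> s.span E"
          by (rule subsetD[OF E(3) right[OF r]])
        then have "?r e ?v = s.representation E ?v e"
          by (simp only: s.representation_extend[OF B(2) _ B(1)])
        also have "\<dots> = 0"
          using that s.representation_ne_zero[of E ?v e] by blast
        finally show ?thesis .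
      qed
      finally show ?thesis .
    qed
    moreover have "(\<Sum>b | ?r b (slice e) \<noteq> 0. s (?r b (slice e)) b) = slice e"
      by (rule s.sum_nonzero_representation_eq[OF B(2)]) (simp add: B(3))
    ultimately show ?thesis by simp
  qed
  \<comment> \<open>The finitely many basis vectors that occur in right legs of
    \<open>x\<close>.\<close>
  define F where "F = (\<Union>p\<in>?K. {e. ?r e (snd p) \<noteq> 0})"
  have F: "finite F" by (simp add: F_def s.finite_representation)
  have expand: "snd p = (\<Sum>e\<in>F. s (?r e (snd p)) e)" if "p \<in> ?K" for p
  proof -
    have "(\<Sum>e | ?r e (snd p) \<noteq> 0. s (?r e (snd p)) e) = snd p"
      by (rule s.sum_nonzero_representation_eq[OF B(2)]) (simp add: B(3))
    moreover have "(\<Sum>e | ?r e (snd p) \<noteq> 0. s (?r e (snd p)) e) = (\<Sum>e\<in>F. s (?r e (snd p)) e)"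
      using that F by (intro sum.mono_neutral_left) (auto simp: F_def)
    ultimately show ?thesis by simp
  qed
  define y where "y = (\<Sum>e\<in>F \<inter> E. gen (slice e, e) :: 'v \<times> 'v \<Rightarrow>\<^sub>0 'k)"
  \<comment> \<open>\<open>z\<close> is \<open>x\<close> with every right leg expanded in the basis.
    Collecting its terms by \<open>e\<close> gives the desired representative \<open>y\<close>, so
    \<open>x\<close> and \<open>y\<close> are compared through \<open>z\<close>.\<close>
  define z where "z = (\<Sum>p\<in>?K. free_scale (?c p) (\<Sum>e\<in>F. free_scale (?r e (snd p)) (gen (fst p, e))))"
  have "x - z \<in> ?R"
  proof -
    have "x - z = (\<Sum>p\<in>?K. free_scale (?c p)
        (gen p - (\<Sum>e\<in>F. free_scale (?r e (snd p)) (gen (fst p, e)))))"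
      using linext_gen_self[of x]
      by (simp add: z_def linext_def f.scale_right_diff_distrib sum_subtractf)
    also have "\<dots> \<in> ?R"
    proof (intro f.subspace_sum[OF R] f.subspace_scale[OF R])
      fix p assume "p \<in> ?K"
      \<comment> \<open>In the free space, \<open>gen\<close> is linear in a leg only modulo the
        relations.\<close>
      have "gen (fst p, \<Sum>e\<in>F. s (?r e (snd p)) e)
          - (\<Sum>e\<in>F. free_scale (?r e (snd p)) (gen (fst p, e))) \<in> ?R"
        by (rule tensor_of_linear_combination[where g = "\<lambda>b. gen (fst p, b)", OF assms(1) R rel(2,4)])
      then show "gen p - (\<Sum>e\<in>F. free_scale (?r e (snd p)) (gen (fst p, e))) \<in> ?R"
        using expand[OF \<open>p \<in> ?K\<close>] by simp
    qed
    finally show ?thesis .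
  qed
  moreover have "y - z \<in> ?R"
  proof -
    \<comment> \<open>For \<open>e\<close> outside \<open>E\<close> the slice vanishes, but
      \<open>gen (0, e)\<close> is still a basis vector of the free space; it is zero only modulo
      the relations.\<close>
    have gen0: "gen (0, e) \<in> ?R" for e using rel(3)[of 0 0 e] by simp
    have "z = (\<Sum>e\<in>F. \<Sum>p\<in>?K. free_scale (?c p * ?r e (snd p)) (gen (fst p, e)))"
      unfolding z_def f.scale_sum_right by (subst sum.swap) simp
    moreover have "(\<Sum>e\<in>F. gen (slice e, e)) = y + (\<Sum>e\<in>F - E. gen (0, e))"
      unfolding y_def using F by (subst sum.Int_Diff[of F _ E]) (auto simp: slice_eq_0)
    ultimately have "y - z = (\<Sum>e\<in>F. gen (slice e, e)
        - (\<Sum>p\<in>?K. free_scale (?c p * ?r e (snd p)) (gen (fst p, e)))) - (\<Sum>e\<in>F - E. gen (0, e))"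
      by (simp add: sum_subtractf algebra_simps)
    also have "\<dots> \<in> ?R"
      unfolding slice_sum
      by (intro f.subspace_diff[OF R] f.subspace_sum[OF R] gen0
          tensor_of_linear_combination[where g = "\<lambda>a. gen (a, e)" for e, OF assms(1) R rel(1,3)])
    finally show ?thesis .
  qed
  ultimately have "(x - z) - (y - z) \<in> ?R" by (rule f.subspace_diff[OF R])
  then have "tensor2 s x = tensor2 s y" by (intro tensor2_eqI) simp
  moreover have "Poly_Mapping.keys y \<subseteq> D \<times> C"
  proof -
    have "Poly_Mapping.keys y \<subseteq> (\<Union>e\<in>F \<inter> E. Poly_Mapping.keys (gen (slice e, e) :: 'v \<times> 'v \<Rightarrow>\<^sub>0 'k))"
      unfolding y_def by (rule keys_sum)
    moreover have "slice e \<in> D" for e unfolding slice_def by (rule left[OF r])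
    ultimately show ?thesis using E(1) by (auto simp: gen_def)
  qed
  ultimately show ?thesis by (auto simp: tensor_of_def)
qed


section \<open>Calculus of Sweedler sums\<close>

lemma (in k_algebra) linear_times_right: "Vector_Spaces.linear scale scale (\<lambda>x. c * x)"
  by unfold_locales (simp_all add: distrib_left scale_mult_right)

lemma (in k_algebra) linear_times_left: "Vector_Spaces.linear scale scale (\<lambda>x. x * c)"
  by unfold_locales (simp_all add: distrib_right scale_mult_left)

context k_coalgebra
begin

abbreviation lin :: "('h \<Rightarrow> 'h) \<Rightarrow> bool"
  where "lin \<equiv> Vector_Spaces.linear scale scale"

abbreviation bilin :: "('h \<Rightarrow> 'h \<Rightarrow> 'h) \<Rightarrow> bool"
  where "bilin \<equiv> bilinear_maps scale scale"

text \<open>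
  In Sweedler notation \<open>sweedler h f\<close> is \<open>f h\<^sub>1 h\<^sub>2\<close>. Identities in \<open>H \<otimes> H\<close> are stated by applying an
  arbitrary bilinear map with values in \<open>H\<close>; such maps separate tensors.
\<close>

abbreviation sweedler :: "'h \<Rightarrow> ('h \<Rightarrow> 'h \<Rightarrow> 'h) \<Rightarrow> 'h"
  where "sweedler h f \<equiv> tensor_eval scale f (comult h)"

lemma sweedler_eq:
  "sweedler h f = (\<Sum>p\<in>Poly_Mapping.keys (rep (comult h)).
    scale (Poly_Mapping.lookup (rep (comult h)) p) (f (fst p) (snd p)))"
  by (simp add: tensor_eval_def linext_def case_prod_beta)

lemma linI:
  assumes "\<And>x y. f (x + y) = f x + f y" "\<And>c x. f (scale c x) = scale c (f x)"
  shows "lin f"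
  using assms by unfold_locales auto

lemma lin_ident: "lin (\<lambda>x. x)"
  by (rule linI) simp_all

lemma lin_scale: "lin f \<Longrightarrow> lin (\<lambda>x. scale c (f x))"
  by (rule linI) (simp_all add: Vector_Spaces.linear_iff scale_right_distrib scale_left_commute)

lemma lin_functional:
  assumes "Vector_Spaces.linear scale (*) \<phi>" "lin f"
  shows "lin (\<lambda>x. scale (\<phi> (f x)) c)"
  using assms by (intro linI) (simp_all add: Vector_Spaces.linear_iff scale_left_distrib)

lemma lin_counit: "lin f \<Longrightarrow> lin (\<lambda>x. scale (counit (f x)) c)"
  by (rule lin_functional[OF counit_linear])

lemma lin_sweedler_body:
  assumes "\<And>a b. lin (\<lambda>x. F x a b)"
  shows "lin (\<lambda>x. sweedler h (F x))"
  using assms unfolding sweedler_eq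
  by (intro linI) (simp_all add: Vector_Spaces.linear_iff scale_right_distrib
      sum.distrib scale_sum_right mult.commute)

lemma comult_tensor2: "tensor2 scale (rep (comult h)) = comult h"
proof -
  obtain x where "comult h = tensor2 scale x"
    using comult_tensor[of h] by (auto simp: tensor_of_def)
  then show ?thesis by (simp add: rep_tensor2)
qed

text \<open>Bilinearity makes the value independent of the representative, so it may be computed on
  the sum or multiple of representatives that the axioms for \<open>comult\<close> supply.\<close>

lemma lin_sweedler_self:
  assumes f: "bilin f"
  shows "lin (\<lambda>h. sweedler h f)"
proof (rule linI)
  interpret L: Vector_Spaces.linear free_scale scale "linext scale (\<lambda>(a, b). f a b)"
    by (rule linear_linext) unfold_locales
  show "sweedler (x + y) f = sweedler x f + sweedler y f" for x y
    unfolding comult_add tensor_add_def tensor_eval_tensor2[OF f]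
    by (simp add: L.add tensor_eval_def)
  show "sweedler (scale c x) f = scale c (sweedler x f)" for c x
    unfolding comult_scale tensor_scale_def tensor_eval_tensor2[OF f]
    by (simp add: L.scale tensor_eval_def)
qed

lemma lin_sweedler_arg:
  assumes "lin g" "bilin f"
  shows "lin (\<lambda>x. sweedler (g x) f)"
  by (rule linear_compose_rule[OF assms(1) lin_sweedler_self[OF assms(2)]])

lemma lin_bilin_left:
  assumes "bilin f" "lin g"
  shows "lin (\<lambda>x. f (g x) c)"
  using assms linear_compose_rule[of scale scale g scale "\<lambda>a. f a c"]
  by (simp add: bilinear_maps_def)

lemma lin_bilin_right:
  assumes "bilin f" "lin g"
  shows "lin (\<lambda>x. f c (g x))"
  using assms linear_compose_rule[of scale scale g scale "f c"]
  by (simp add: bilinear_maps_def)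

lemmas lin_intros = bilinear_mapsI lin_ident lin_scale lin_counit lin_sweedler_body lin_sweedler_arg

lemma lin_sweedler: "lin g \<Longrightarrow> g (sweedler h f) = sweedler h (\<lambda>a b. g (f a b))"
  unfolding tensor_eval_def by (subst linear_linext_commute) (simp_all add: case_prod_beta')

lemma sweedler_swap:
  "sweedler g (\<lambda>a b. sweedler h (\<lambda>c d. t a b c d)) = sweedler h (\<lambda>c d. sweedler g (\<lambda>a b. t a b c d))"
  unfolding sweedler_eq scale_sum_right
  by (subst sum.swap) (simp add: mult.commute)

lemma sweedler_scale: "sweedler h (\<lambda>a b. scale c (f a b)) = scale c (sweedler h f)"
  by (rule lin_sweedler[symmetric]) (intro lin_intros)

text \<open>Both sides evaluate the trilinear map \<open>t\<close> on representatives of the two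
  sides of \<open>coassoc\<close>.\<close>

lemma sweedler_assoc:
  assumes t: "\<And>b c. lin (\<lambda>a. t a b c)" "\<And>a c. lin (\<lambda>b. t a b c)" "\<And>a b. lin (\<lambda>c. t a b c)"
  shows "sweedler h (\<lambda>x c. sweedler x (\<lambda>a b. t a b c)) = sweedler h (\<lambda>a x. sweedler x (\<lambda>b c. t a b c))"
proof -
  let ?L = "linext scale (\<lambda>(a, b, c). t a b c)"
  have v: "vector_space scale" ..
  have L: "Vector_Spaces.linear free_scale scale ?L"
    by (rule linear_linext) (rule v)
  note comm = linear_linext_commute[OF L, unfolded case_prod_beta']
  from linext_tensor3_cong[where t = t and s = scale and s' = scale,
      OF t coassoc[of h, unfolded tensor_map_left_def tensor_map_right_def]]
  show ?thesis
    by (simp add: comm case_prod_beta' linext_gen[OF v] tensor_eval_def)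
qed

lemma sweedler_counit_left: "lin f \<Longrightarrow> sweedler h (\<lambda>a b. scale (counit a) (f b)) = f h"
  using lin_sweedler[of f "\<lambda>a b. scale (counit a) b" h]
  by (simp add: counit_left Vector_Spaces.linear_iff)

lemma sweedler_counit_right: "lin f \<Longrightarrow> sweedler h (\<lambda>a b. scale (counit b) (f a)) = f h"
  using lin_sweedler[of f "\<lambda>a b. scale (counit b) a" h]
  by (simp add: counit_right Vector_Spaces.linear_iff)

end

section \<open>Sweedler sums of products and antipodes\<close>

context hopf_algebra
begin

lemma lin_times_left: "lin f \<Longrightarrow> lin (\<lambda>x. f x * c)"
  by (rule linear_compose_rule[OF _ linear_times_left])

lemma lin_times_right: "lin f \<Longrightarrow> lin (\<lambda>x. c * f x)"
  by (rule linear_compose_rule[OF _ linear_times_right])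

lemma lin_antipode: "lin f \<Longrightarrow> lin (\<lambda>x. antipode (f x))"
  by (rule linear_compose_rule[OF _ antipode_linear])

lemmas lin_rules = lin_intros lin_times_left lin_times_right lin_antipode

lemma sweedler_mult:
  assumes f: "bilin f"
  shows "sweedler (g * h) f = sweedler g (\<lambda>a b. sweedler h (\<lambda>c d. f (a * c) (b * d)))"
proof -
  have v: "vector_space scale" ..
  note comm = linear_linext_commute[OF linear_linext[OF v]]
  show ?thesis
    unfolding comult_mult tensor_mult_def tensor_eval_tensor2[OF f]
    by (simp add: comm case_prod_beta' linext_gen[OF v] tensor_eval_def)
qed

lemma sweedler_one: "bilin f \<Longrightarrow> sweedler 1 f = f 1 1"
  by (simp add: comult_one tensor_eval_tensor2 linext_gen[OF vector_space_axioms])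

lemma sweedler_antipode_left: "lin f \<Longrightarrow> sweedler h (\<lambda>a b. f (antipode a * b)) = scale (counit h) (f 1)"
  using lin_sweedler[of f "\<lambda>a b. antipode a * b" h]
  by (simp add: antipode_left Vector_Spaces.linear_iff)

lemma sweedler_antipode_right: "lin f \<Longrightarrow> sweedler h (\<lambda>a b. f (a * antipode b)) = scale (counit h) (f 1)"
  using lin_sweedler[of f "\<lambda>a b. a * antipode b" h]
  by (simp add: antipode_right Vector_Spaces.linear_iff)


section \<open>The antipode\<close>

lemma antipode_one: "antipode 1 = 1"
  using sweedler_antipode_right[OF lin_ident, of 1] sweedler_one[of "\<lambda>a b. a * antipode b"]
  by (simp add: counit_one lin_rules)

text \<open>Both sides are read off from \<open>S(a\<^sub>1b\<^sub>1) a\<^sub>2b\<^sub>2 S(b\<^sub>3) S(a\<^sub>3)\<close>, by cancelling the right or the left half.\<close>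

lemma antipode_mult: "antipode (a * b) = antipode b * antipode a"
proof -
  let ?t = "\<lambda>a1 a2 a3 b1 b2 b3. antipode (a1 * b1) * (a2 * b2) * (antipode b3 * antipode a3)"
  have right1: "sweedler b' (\<lambda>b2 b3. ?t a1 a2 a3 b1 b2 b3)
      = scale (counit b') (antipode (a1 * b1) * (a2 * antipode a3))" for b' a1 a2 a3 b1
    using sweedler_antipode_right[of "\<lambda>x. antipode (a1 * b1) * (a2 * (x * antipode a3))" b']
    by (simp add: mult.assoc lin_rules)
  have right2: "sweedler a' (\<lambda>a2 a3. scale c (antipode (a1 * b1) * (a2 * antipode a3)))
      = scale (counit a') (scale c (antipode (a1 * b1)))" for a' a1 b1 c
    using sweedler_antipode_right[of "\<lambda>x. scale c (antipode (a1 * b1) * x)" a']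
    by (simp add: lin_rules)
  \<comment> \<open>This is the left antipode axiom for the single element \<open>x * y\<close>,
    with its coproduct expanded by \<open>sweedler_mult\<close>.\<close>
  have left: "sweedler x (\<lambda>a1 a2. sweedler y (\<lambda>b1 b2. ?t a1 a2 a3 b1 b2 b3))
      = scale (counit x) (scale (counit y) (antipode b3 * antipode a3))" for x y a3 b3
    using sweedler_antipode_left[of "\<lambda>z. z * (antipode b3 * antipode a3)" "x * y"]
    by (simp add: sweedler_mult counit_mult lin_rules)
  have assoc_b: "sweedler b (\<lambda>b1 b'. sweedler b' (\<lambda>b2 b3. ?t a1 a2 a3 b1 b2 b3))
      = sweedler b (\<lambda>y b3. sweedler y (\<lambda>b1 b2. ?t a1 a2 a3 b1 b2 b3))" for a1 a2 a3
    by (rule sweedler_assoc[symmetric]; intro lin_rules)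
  have counit_b: "sweedler b (\<lambda>b1 b'. scale c (scale (counit b') (antipode (a1 * b1))))
      = scale c (antipode (a1 * b))" for a1 c
    using sweedler_counit_right[of "\<lambda>x. antipode (a1 * x)" b]
    by (simp add: sweedler_scale lin_rules del: scale_scale)
  have counit_b': "sweedler b (\<lambda>y b3. scale c (scale (counit y) (antipode b3 * antipode a3)))
      = scale c (antipode b * antipode a3)" for a3 c
    using sweedler_counit_left[of "\<lambda>x. antipode x * antipode a3" b]
    by (simp add: sweedler_scale lin_rules del: scale_scale)
  have "antipode (a * b) = sweedler a (\<lambda>a1 a'. sweedler b (\<lambda>b1 b'.
      scale (counit a') (scale (counit b') (antipode (a1 * b1)))))"
    using sweedler_counit_right[of "\<lambda>x. antipode (x * b)" a]
    by (simp add: counit_b lin_rules del: scale_scale)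
  also have "\<dots> = sweedler a (\<lambda>a1 a'. sweedler b (\<lambda>b1 b'.
      sweedler a' (\<lambda>a2 a3. sweedler b' (\<lambda>b2 b3. ?t a1 a2 a3 b1 b2 b3))))"
    by (simp only: right1 right2)
  also have "\<dots> = sweedler a (\<lambda>a1 a'. sweedler a' (\<lambda>a2 a3.
      sweedler b (\<lambda>b1 b'. sweedler b' (\<lambda>b2 b3. ?t a1 a2 a3 b1 b2 b3))))"
    by (subst sweedler_swap) simp
  also have "\<dots> = sweedler a (\<lambda>a1 a'. sweedler a' (\<lambda>a2 a3.
      sweedler b (\<lambda>y b3. sweedler y (\<lambda>b1 b2. ?t a1 a2 a3 b1 b2 b3))))"
    by (simp only: assoc_b)
  also have "\<dots> = sweedler a (\<lambda>x a3. sweedler x (\<lambda>a1 a2.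
      sweedler b (\<lambda>y b3. sweedler y (\<lambda>b1 b2. ?t a1 a2 a3 b1 b2 b3))))"
    by (rule sweedler_assoc[symmetric]; intro lin_rules)
  also have "\<dots> = sweedler a (\<lambda>x a3. sweedler b (\<lambda>y b3. sweedler x (\<lambda>a1 a2.
      sweedler y (\<lambda>b1 b2. ?t a1 a2 a3 b1 b2 b3))))"
    by (subst sweedler_swap) simp
  also have "\<dots> = antipode b * antipode a"
    using sweedler_counit_left[of "\<lambda>x. antipode b * antipode x" a]
    by (simp only: left counit_b') (simp add: lin_rules)
  finally show ?thesis .
qed

text \<open>
  Here the auxiliary sum is \<open>\<Delta>(S(h\<^sub>1)) (h\<^sub>2 \<otimes> h\<^sub>3) (S(h\<^sub>5) \<otimes> S(h\<^sub>4))\<close>.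
\<close>

lemma sweedler_antipode:
  assumes f: "bilin f"
  shows "sweedler (antipode h) f = sweedler h (\<lambda>a b. f (antipode b) (antipode a))"
proof -
  note rules = lin_rules lin_bilin_left[OF f] lin_bilin_right[OF f]
  let ?t = "\<lambda>u v b c d e. f (u * b * antipode e) (v * c * antipode d)"
  \<comment> \<open>The neighbours \<open>c\<close>, \<open>d\<close> cancel first; only then do
    \<open>b\<close> and \<open>e\<close> become adjacent and cancel.\<close>
  have right: "sweedler r (\<lambda>b x. sweedler x (\<lambda>c y. sweedler y (\<lambda>d e. ?t u v b c d e)))
      = scale (counit r) (f u v)" for r u v
  proof -
    have "sweedler x (\<lambda>c y. sweedler y (\<lambda>d e. ?t u v b c d e)) = f (u * b * antipode x) v" for x b
    proof -
      have "sweedler x (\<lambda>c y. sweedler y (\<lambda>d e. ?t u v b c d e))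
          = sweedler x (\<lambda>z e. sweedler z (\<lambda>c d. ?t u v b c d e))"
        by (rule sweedler_assoc[symmetric]; intro rules)
      also have "\<dots> = sweedler x (\<lambda>z e. scale (counit z) (f (u * b * antipode e) v))"
      proof -
        have "sweedler z (\<lambda>c d. ?t u v b c d e) = scale (counit z) (f (u * b * antipode e) v)" for z e
          using sweedler_antipode_right[of "\<lambda>w. f (u * b * antipode e) (v * w)" z]
          by (simp add: mult.assoc rules)
        then show ?thesis by simp
      qed
      also have "\<dots> = f (u * b * antipode x) v"
        by (rule sweedler_counit_left; intro rules)
      finally show ?thesis .
    qed
    moreover have "sweedler r (\<lambda>b x. f (u * b * antipode x) v) = scale (counit r) (f u v)"
      using sweedler_antipode_right[of "\<lambda>w. f (u * w) v" r] by (simp add: mult.assoc rules)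
    ultimately show ?thesis by simp
  qed
  \<comment> \<open>By multiplicativity, the coproducts of \<open>antipode a\<close> and
    \<open>y\<close> combine to that of \<open>antipode a * y\<close>, and the antipode axiom
    reduces this to the coproduct of 1.\<close>
  have left: "sweedler x (\<lambda>a y. sweedler (antipode a) (\<lambda>u v. sweedler y (\<lambda>b c.
        sweedler z (\<lambda>d e. ?t u v b c d e))))
      = scale (counit x) (sweedler z (\<lambda>d e. f (antipode e) (antipode d)))" for x z
    using sweedler_antipode_left[of "\<lambda>w. sweedler w (\<lambda>p q. sweedler z (\<lambda>d e. f (p * antipode e) (q * antipode d)))" x]
    by (simp add: sweedler_mult sweedler_one rules)
  have "sweedler (antipode h) f = sweedler h (\<lambda>a r. sweedler (antipode a) (\<lambda>u v. scale (counit r) (f u v)))"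
    using sweedler_counit_right[of "\<lambda>x. sweedler (antipode x) f" h]
    by (simp add: sweedler_scale rules f del: scale_scale)
  also have "\<dots> = sweedler h (\<lambda>a r. sweedler (antipode a) (\<lambda>u v.
      sweedler r (\<lambda>b x. sweedler x (\<lambda>c y. sweedler y (\<lambda>d e. ?t u v b c d e)))))"
    by (simp only: right)
  also have "\<dots> = sweedler h (\<lambda>a r. sweedler (antipode a) (\<lambda>u v.
      sweedler r (\<lambda>y z. sweedler y (\<lambda>b c. sweedler z (\<lambda>d e. ?t u v b c d e)))))"
  proof -
    have "sweedler r (\<lambda>b x. sweedler x (\<lambda>c y. sweedler y (\<lambda>d e. ?t u v b c d e)))
        = sweedler r (\<lambda>y z. sweedler y (\<lambda>b c. sweedler z (\<lambda>d e. ?t u v b c d e)))" for r u v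
      by (rule sweedler_assoc[symmetric]; intro rules)
    then show ?thesis by simp
  qed
  also have "\<dots> = sweedler h (\<lambda>a r. sweedler r (\<lambda>y z. sweedler (antipode a) (\<lambda>u v.
      sweedler y (\<lambda>b c. sweedler z (\<lambda>d e. ?t u v b c d e)))))"
    by (subst sweedler_swap) simp
  also have "\<dots> = sweedler h (\<lambda>x z. sweedler x (\<lambda>a y. sweedler (antipode a) (\<lambda>u v.
      sweedler y (\<lambda>b c. sweedler z (\<lambda>d e. ?t u v b c d e)))))"
    by (rule sweedler_assoc[symmetric]; intro rules)
  also have "\<dots> = sweedler h (\<lambda>d e. f (antipode e) (antipode d))"
    by (simp only: left) (rule sweedler_counit_left; intro rules)
  finally show ?thesis .
qed


section \<open>The adjoint action\<close>

lemma ad_linear_left: "lin (\<lambda>k. ad k h)"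
  unfolding ad_def by (intro lin_rules)

lemma ad_linear_right: "lin (ad k)"
  unfolding ad_def by (intro lin_rules)

lemma lin_ad_left: "lin f \<Longrightarrow> lin (\<lambda>x. ad (f x) h)"
  by (rule linear_compose_rule[OF _ ad_linear_left])

text \<open>The antipode reverses products, so the factors from \<open>k\<close> stay next to
  \<open>h\<close> on both sides.\<close>

lemma ad_mult: "ad (g * k) h = ad g (ad k h)"
proof -
  have "sweedler k (\<lambda>c d. a * c * h * (antipode d * antipode b)) = a * ad k h * antipode b" for a b
    using lin_sweedler[of "\<lambda>x. a * x * antipode b" "\<lambda>c d. c * h * antipode d" k]
    by (simp add: ad_def mult.assoc lin_rules)
  then show ?thesis
    unfolding ad_def[of "g * k"] ad_def[of g]
    by (subst sweedler_mult) (simp_all only: antipode_mult lin_rules)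
qed

lemma ad_one_right: "ad k 1 = scale (counit k) 1"
  unfolding ad_def using sweedler_antipode_right[OF lin_ident, of k] by simp

text \<open>In \<open>k\<^sub>1 a S(k\<^sub>2) k\<^sub>3 b S(k\<^sub>4)\<close> the middle factors
  \<open>S(k\<^sub>2) k\<^sub>3\<close> cancel.\<close>

lemma ad_times: "ad k (a * b) = sweedler k (\<lambda>x y. ad x a * ad y b)"
proof -
  let ?t = "\<lambda>p q s t. p * a * antipode q * (s * b * antipode t)"
  have cancel: "sweedler w (\<lambda>q s. ?t p q s t) = scale (counit w) (p * a * (b * antipode t))" for w p t
    using sweedler_antipode_left[of "\<lambda>x. p * a * (x * (b * antipode t))" w]
    by (simp add: mult.assoc lin_rules)
  have "sweedler k (\<lambda>x y. ad x a * ad y b)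
      = sweedler k (\<lambda>x y. sweedler x (\<lambda>p q. sweedler y (\<lambda>s t. ?t p q s t)))"
  proof -
    have "ad x a * ad y b = sweedler x (\<lambda>p q. sweedler y (\<lambda>s t. ?t p q s t))" for x y
    proof -
      have "u * ad y b = sweedler y (\<lambda>s t. u * (s * b * antipode t))" for u
        unfolding ad_def by (rule lin_sweedler) (intro lin_rules)
      moreover have "ad x a * ad y b = sweedler x (\<lambda>p q. p * a * antipode q * ad y b)"
        unfolding ad_def[of x] by (rule lin_sweedler) (intro lin_rules)
      ultimately show ?thesis by simp
    qed
    then show ?thesis by simp
  qed
  also have "\<dots> = sweedler k (\<lambda>p x. sweedler x (\<lambda>q y. sweedler y (\<lambda>s t. ?t p q s t)))"
    by (rule sweedler_assoc; intro lin_rules)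
  also have "\<dots> = sweedler k (\<lambda>p x. sweedler x (\<lambda>w t. sweedler w (\<lambda>q s. ?t p q s t)))"
  proof -
    have "sweedler x (\<lambda>q y. sweedler y (\<lambda>s t. ?t p q s t))
        = sweedler x (\<lambda>w t. sweedler w (\<lambda>q s. ?t p q s t))" for x p
      by (rule sweedler_assoc[symmetric]; intro lin_rules)
    then show ?thesis by simp
  qed
  also have "\<dots> = sweedler k (\<lambda>p x. p * a * (b * antipode x))"
  proof -
    have "sweedler x (\<lambda>w t. sweedler w (\<lambda>q s. ?t p q s t)) = p * a * (b * antipode x)" for x p
      unfolding cancel by (rule sweedler_counit_left; intro lin_rules)
    then show ?thesis by simp
  qed
  finally show ?thesis by (simp add: ad_def mult.assoc)
qed

text \<open>Here \<open>p\<close>, \<open>q\<close>, \<open>s\<close>, \<open>t\<close> are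
  \<open>k\<^sub>1\<close>, ..., \<open>k\<^sub>4\<close>. The antipode reverses the coproduct, so
  the outer two end up in the left leg and the inner two in the right leg.\<close>

lemma sweedler_ad:
  assumes f: "bilin f"
  shows "sweedler (ad k h) f = sweedler k (\<lambda>x y. sweedler x (\<lambda>p q. sweedler y (\<lambda>s t.
    sweedler h (\<lambda>a b. f (p * a * antipode t) (q * b * antipode s)))))"
proof -
  note rules = lin_rules lin_bilin_left[OF f] lin_bilin_right[OF f]
  have "sweedler (x * h * antipode y) f = sweedler x (\<lambda>p q. sweedler y (\<lambda>s t.
    sweedler h (\<lambda>a b. f (p * a * antipode t) (q * b * antipode s))))" for x y
  proof -
    have "sweedler (x * h * antipode y) f = sweedler x (\<lambda>p q. sweedler h (\<lambda>a b.
        sweedler (antipode y) (\<lambda>c d. f (p * a * c) (q * b * d))))"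
      by (simp add: sweedler_mult f rules)
    also have "\<dots> = sweedler x (\<lambda>p q. sweedler h (\<lambda>a b.
        sweedler y (\<lambda>s t. f (p * a * antipode t) (q * b * antipode s))))"
      by (simp add: sweedler_antipode rules)
    also have "\<dots> = sweedler x (\<lambda>p q. sweedler y (\<lambda>s t.
        sweedler h (\<lambda>a b. f (p * a * antipode t) (q * b * antipode s))))"
      by (subst sweedler_swap) simp
    finally show ?thesis .
  qed
  then show ?thesis
    unfolding ad_def lin_sweedler[OF lin_sweedler_self[OF f]] by simp
qed

text \<open>With \<open>u\<close>, \<open>p\<close>, \<open>q\<close>, \<open>s\<close>,
  \<open>t\<close>, \<open>w\<close> the six legs of \<open>k\<close>, the adjacent pairs
  \<open>S(u) p\<close> and \<open>S(t) w\<close> cancel and leave \<open>q\<close> and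
  \<open>s\<close>. Keeping \<open>g\<close> abstract serves both legs of the coproduct of
  \<open>ad k h\<close>.\<close>

lemma sweedler_conjugate_cancel:
  assumes g: "\<And>b c d. lin (\<lambda>a. g a b c d)" "\<And>a c d. lin (\<lambda>b. g a b c d)"
    "\<And>a b d. lin (\<lambda>c. g a b c d)" "\<And>a b c. lin (\<lambda>d. g a b c d)"
  shows "sweedler k (\<lambda>u r. sweedler r (\<lambda>m w. sweedler m (\<lambda>x y.
      sweedler x (\<lambda>p q. sweedler y (\<lambda>s t. g (antipode u * p) q s (antipode t * w))))))
    = sweedler k (\<lambda>q s. g 1 q s 1)"
proof -
  have "lin f \<Longrightarrow> lin (\<lambda>x. g (f x) b c d)" "lin f \<Longrightarrow> lin (\<lambda>x. g b (f x) c d)"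
    "lin f \<Longrightarrow> lin (\<lambda>x. g b c (f x) d)" "lin f \<Longrightarrow> lin (\<lambda>x. g b c d (f x))" for f b c d
    by (rule linear_compose_rule[of scale scale f], assumption, rule g)+
  note rules = this lin_rules
  let ?t = "\<lambda>u p q s t w. g (antipode u * p) q s (antipode t * w)"
  have inner: "sweedler r (\<lambda>m w. sweedler m (\<lambda>x y. sweedler x (\<lambda>p q. sweedler y (\<lambda>s t. ?t u p q s t w))))
    = sweedler r (\<lambda>p y. sweedler y (\<lambda>q z. g (antipode u * p) q z 1))" for r u
  proof -
    have "sweedler r (\<lambda>m w. sweedler m (\<lambda>x y. sweedler x (\<lambda>p q. sweedler y (\<lambda>s t. ?t u p q s t w))))
        = sweedler r (\<lambda>x z. sweedler z (\<lambda>y w. sweedler x (\<lambda>p q. sweedler y (\<lambda>s t. ?t u p q s t w))))"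
      by (rule sweedler_assoc; intro rules)
    also have "\<dots> = sweedler r (\<lambda>x z. sweedler x (\<lambda>p q. sweedler z (\<lambda>y w. sweedler y (\<lambda>s t. ?t u p q s t w))))"
      by (subst sweedler_swap) simp
    also have "\<dots> = sweedler r (\<lambda>x z. sweedler x (\<lambda>p q. g (antipode u * p) q z 1))"
    proof -
      have "sweedler z (\<lambda>y w. sweedler y (\<lambda>s t. ?t u p q s t w)) = g (antipode u * p) q z 1" for z p q
      proof -
        have "sweedler z (\<lambda>y w. sweedler y (\<lambda>s t. ?t u p q s t w))
            = sweedler z (\<lambda>s v. sweedler v (\<lambda>t w. ?t u p q s t w))"
          by (rule sweedler_assoc; intro rules)
        also have "\<dots> = sweedler z (\<lambda>s v. scale (counit v) (g (antipode u * p) q s 1))"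
          using sweedler_antipode_left[of "g (antipode u * p) q s" for s] by (simp add: rules)
        also have "\<dots> = g (antipode u * p) q z 1"
          by (rule sweedler_counit_right; intro rules)
        finally show ?thesis .
      qed
      then show ?thesis by simp
    qed
    also have "\<dots> = sweedler r (\<lambda>p y. sweedler y (\<lambda>q z. g (antipode u * p) q z 1))"
      by (rule sweedler_assoc; intro rules)
    finally show ?thesis .
  qed
  have "sweedler k (\<lambda>u r. sweedler r (\<lambda>p y. sweedler y (\<lambda>q z. g (antipode u * p) q z 1)))
      = sweedler k (\<lambda>x y. sweedler x (\<lambda>u p. sweedler y (\<lambda>q z. g (antipode u * p) q z 1)))"
    by (rule sweedler_assoc[symmetric]; intro rules)
  also have "\<dots> = sweedler k (\<lambda>x y. scale (counit x) (sweedler y (\<lambda>q z. g 1 q z 1)))"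
  proof -
    have "sweedler x (\<lambda>u p. sweedler y (\<lambda>q z. g (antipode u * p) q z 1))
        = scale (counit x) (sweedler y (\<lambda>q z. g 1 q z 1))" for x y
      by (rule sweedler_antipode_left; intro rules)
    then show ?thesis by simp
  qed
  also have "\<dots> = sweedler k (\<lambda>q s. g 1 q s 1)"
    by (rule sweedler_counit_left; intro rules)
  finally show ?thesis unfolding inner .
qed

text \<open>Conjugating the left leg strips off the outer factors that \<open>sweedler_ad\<close>
  puts there. On the right-hand side \<open>h\<close> enters only through \<open>ad m h\<close>,
  which stays in a finite-dimensional space if \<open>h\<close> is in \<open>ad_fin\<close>.\<close>

lemma sweedler_ad_right_leg:
  assumes f: "bilin f"
  shows "sweedler h (\<lambda>a b. f a (ad k b))
    = sweedler k (\<lambda>u r. sweedler r (\<lambda>m w. sweedler (ad m h) (\<lambda>a b. f (antipode u * a * w) b)))"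
proof -
  note rules = lin_rules lin_bilin_left[OF f] lin_bilin_right[OF f]
  let ?g = "\<lambda>x q s y. sweedler h (\<lambda>a b. f (x * a * y) (q * b * antipode s))"
  have "sweedler (ad m h) (\<lambda>a b. f (antipode u * a * w) b) = sweedler m (\<lambda>x y.
      sweedler x (\<lambda>p q. sweedler y (\<lambda>s t. ?g (antipode u * p) q s (antipode t * w))))" for m u w
    by (subst sweedler_ad) (simp_all add: rules mult.assoc)
  then have "sweedler k (\<lambda>u r. sweedler r (\<lambda>m w. sweedler (ad m h) (\<lambda>a b. f (antipode u * a * w) b)))
      = sweedler k (\<lambda>q s. ?g 1 q s 1)"
    using sweedler_conjugate_cancel[of ?g k] by (simp add: rules)
  also have "\<dots> = sweedler h (\<lambda>a b. sweedler k (\<lambda>q s. f a (q * b * antipode s)))"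
    by (subst sweedler_swap) simp
  also have "\<dots> = sweedler h (\<lambda>a b. f a (ad k b))"
    unfolding ad_def using lin_sweedler[of "f a" for a] by (simp add: rules)
  finally show ?thesis by simp
qed


section \<open>The locally finite part\<close>

text \<open>\<open>finite_dim\<close> asks for a finite set that spans exactly \<open>V\<close>; a
  basis of \<open>V\<close> is one, as independent sets in \<open>span R\<close> are finite.\<close>

lemma finite_dimI:
  assumes "subspace V" "finite R" "V \<subseteq> span R"
  shows "finite_dim V"
proof -
  obtain B where "B \<subseteq> V" "independent B" "V \<subseteq> span B" using basis_exists by metis
  moreover have "finite B"
    using independent_span_bound[OF assms(2) \<open>independent B\<close>] calculation(1) assms(3) by auto
  ultimately show ?thesis
    using span_subspace[OF _ _ assms(1)] unfolding finite_dim_def by blast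
qed

text \<open>The orbit is the image of the linear map sending \<open>k\<close> to
  \<open>ad k h\<close>, hence a subspace, so a finitely spanned upper bound is enough.\<close>

lemma ad_fin_iff: "h \<in> ad_fin \<longleftrightarrow> (\<exists>R. finite R \<and> (\<forall>k. ad k h \<in> span R))"
proof
  assume "h \<in> ad_fin"
  then show "\<exists>R. finite R \<and> (\<forall>k. ad k h \<in> span R)"
    by (auto simp: ad_fin_def finite_dim_def ad_orbit_def)
next
  assume "\<exists>R. finite R \<and> (\<forall>k. ad k h \<in> span R)"
  then obtain R where R: "finite R" "\<And>k. ad k h \<in> span R" by blast
  interpret L: Vector_Spaces.linear scale scale "\<lambda>k. ad k h" by (rule ad_linear_left)
  have "subspace (range (\<lambda>k. ad k h))"
    by (rule L.subspace_image) simp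
  then have "subspace (ad_orbit h)"
    by (simp add: ad_orbit_def full_SetCompr_eq)
  with R show "h \<in> ad_fin"
    by (auto simp: ad_fin_def ad_orbit_def intro!: finite_dimI)
qed

lemma ad_finI: "finite R \<Longrightarrow> (\<And>k. ad k h \<in> span R) \<Longrightarrow> h \<in> ad_fin"
  using ad_fin_iff by blast

lemma sweedler_in_subspace:
  assumes "subspace V"
    and "\<And>p. p \<in> Poly_Mapping.keys (rep (comult h)) \<Longrightarrow> f (fst p) (snd p) \<in> V"
  shows "sweedler h f \<in> V"
  unfolding sweedler_eq using assms by (intro subspace_sum subspace_scale) auto

lemma lin_image_span:
  assumes "lin f" "x \<in> span B" "f ` B \<subseteq> span R"
  shows "f x \<in> span R"
proof -
  interpret f: Vector_Spaces.linear scale scale f by fact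
  have "f x \<in> span (f ` B)" using assms(2) by (simp add: f.span_image)
  also have "\<dots> \<subseteq> span R" by (rule span_minimal[OF assms(3)]) simp
  finally show ?thesis .
qed

lemma subspace_ad_fin: "subspace ad_fin"
proof (rule subspaceI)
  note [simp] = ad_linear_right[unfolded Vector_Spaces.linear_iff]
  have "ad k 0 = 0" for k
    by (metis ad_linear_right Vector_Spaces.linear_iff scale_zero_left)
  then show "0 \<in> ad_fin" by (intro ad_finI[of "{}"]) auto
  fix x assume "x \<in> ad_fin"
  then obtain R where R: "finite R" "\<And>k. ad k x \<in> span R" unfolding ad_fin_iff by blast
  then show "scale c x \<in> ad_fin" for c
    by (intro ad_finI[of R]) (auto intro: span_scale)
  fix y assume "y \<in> ad_fin"
  then obtain R' where R': "finite R'" "\<And>k. ad k y \<in> span R'" unfolding ad_fin_iff by blast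
  have "span R \<subseteq> span (R \<union> R')" "span R' \<subseteq> span (R \<union> R')" by (auto intro!: span_mono)
  with R R' show "x + y \<in> ad_fin"
    by (intro ad_finI[of "R \<union> R'"]) (auto intro!: span_add)
qed

lemma subalgebra_ad_fin: "subalgebra ad_fin"
  unfolding subalgebra_def
proof (intro conjI ballI subspace_ad_fin)
  show "1 \<in> ad_fin"
    by (intro ad_finI[of "{1}"]) (auto simp: ad_one_right intro: span_scale span_base)
  fix x y assume "x \<in> ad_fin" "y \<in> ad_fin"
  then obtain R R' where R: "finite R" "\<And>k. ad k x \<in> span R"
    and R': "finite R'" "\<And>k. ad k y \<in> span R'" unfolding ad_fin_iff by metis
  \<comment> \<open>By \<open>ad_times\<close> the orbit of \<open>x * y\<close> consists of sums of
    products of elements of the two orbits.\<close>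
  let ?P = "(\<lambda>(a, b). a * b) ` (R \<times> R')"
  have "a * b \<in> span ?P" if a: "a \<in> span R" and b: "b \<in> span R'" for a b
  proof (rule lin_image_span[OF _ a])
    show "lin (\<lambda>a. a * b)" by (intro lin_rules)
    have "a * b \<in> span ?P" if "a \<in> R" for a
      by (rule lin_image_span[OF _ b]) (use that in \<open>auto intro!: span_base lin_rules\<close>)
    then show "(\<lambda>a. a * b) ` R \<subseteq> span ?P" by auto
  qed
  with R R' show "x * y \<in> ad_fin"
    by (intro ad_finI[of ?P]) (auto simp: ad_times intro!: sweedler_in_subspace)
qed

section \<open>The left coideal condition\<close>

lemma ad_fin_right_slice:
  assumes h: "h \<in> ad_fin" and \<phi>: "Vector_Spaces.linear scale (*) \<phi>"
  shows "sweedler h (\<lambda>a b. scale (\<phi> a) b) \<in> ad_fin"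
proof -
  note rules = lin_rules lin_functional[OF \<phi>]
  obtain B where B: "finite B" "\<And>k. ad k h \<in> span B" using h unfolding ad_fin_iff by blast
  \<comment> \<open>The finitely many right legs in the coproducts of a spanning set of the
    orbit.\<close>
  let ?R = "\<Union>v\<in>B. snd ` Poly_Mapping.keys (rep (comult v))"
  \<comment> \<open>The slice is linear in the element whose coproduct is taken, so it is enough to
    look at elements of \<open>B\<close> in place of \<open>ad m h\<close>.\<close>
  have slice: "sweedler (ad m h) (\<lambda>a b. scale (\<phi> (u * a * w)) b) \<in> span ?R" for m u w
  proof (rule lin_image_span[OF _ B(2)])
    show "lin (\<lambda>v. sweedler v (\<lambda>a b. scale (\<phi> (u * a * w)) b))" by (intro rules)
    show "(\<lambda>v. sweedler v (\<lambda>a b. scale (\<phi> (u * a * w)) b)) ` B \<subseteq> span ?R"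
      by (intro image_subsetI sweedler_in_subspace[OF subspace_span] span_scale span_base) force
  qed
  have "ad k (sweedler h (\<lambda>a b. scale (\<phi> a) b)) \<in> span ?R" for k
  proof -
    have "ad k (sweedler h (\<lambda>a b. scale (\<phi> a) b)) = sweedler h (\<lambda>a b. scale (\<phi> a) (ad k b))"
      using lin_sweedler[OF ad_linear_right[of k]] ad_linear_right[of k]
      by (simp add: Vector_Spaces.linear_iff)
    also have "\<dots> \<in> span ?R"
      by (subst sweedler_ad_right_leg)
        (intro rules sweedler_in_subspace[OF subspace_span] slice)+
    finally show ?thesis .
  qed
  with B show ?thesis by (intro ad_finI[of ?R]) auto
qed

text \<open>With \<open>D = UNIV\<close> this yields the coideal condition, with
  \<open>D = C\<close> the coproduct condition of a Hopf subalgebra.\<close>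

lemma comult_in_tensor_ofI:
  assumes "\<And>\<phi>. Vector_Spaces.linear scale (*) \<phi> \<Longrightarrow> sweedler h (\<lambda>a b. scale (\<phi> a) b) \<in> C"
    and "\<And>\<phi>. Vector_Spaces.linear scale (*) \<phi> \<Longrightarrow> sweedler h (\<lambda>a b. scale (\<phi> b) a) \<in> D"
  shows "comult h \<in> tensor_of scale D C"
  using tensor2_in_tensor_ofI[OF vector_space_axioms, of "rep (comult h)" C D] assms
  by (simp add: comult_tensor2 tensor_eval_def)

lemma left_coideal_subalgebra_ad_fin: "left_coideal_subalgebra ad_fin"
  unfolding left_coideal_subalgebra_def
  using subalgebra_ad_fin ad_fin_right_slice comult_in_tensor_ofI by blast


section \<open>Virtually cocommutative Hopf algebras\<close>

lemma ad_fin_if_fin_gen: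
  assumes "fin_gen_right_module K" "finite R" "\<And>k. k \<in> K \<Longrightarrow> ad k h \<in> span R"
  shows "h \<in> ad_fin"
proof -
  obtain X where X: "finite X" "\<And>g. \<exists>c. (\<forall>x\<in>X. c x \<in> K) \<and> g = (\<Sum>x\<in>X. x * c x)"
    using assms(1) unfolding fin_gen_right_module_def by blast
  let ?R = "\<Union>x\<in>X. ad x ` R"
  have "ad g h \<in> span ?R" for g
  proof -
    obtain c where c: "\<And>x. x \<in> X \<Longrightarrow> c x \<in> K" "g = (\<Sum>x\<in>X. x * c x)" using X(2) by blast
    interpret L: Vector_Spaces.linear scale scale "\<lambda>k. ad k h" by (rule ad_linear_left)
    have "ad g h = (\<Sum>x\<in>X. ad x (ad (c x) h))" by (simp add: c(2) L.sum ad_mult)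
    also have "\<dots> \<in> span ?R"
    proof (rule span_sum)
      fix x assume "x \<in> X"
      then show "ad x (ad (c x) h) \<in> span ?R"
        by (intro lin_image_span[OF ad_linear_right assms(3)[OF c(1)]]) (auto intro: span_base)
    qed
    finally show ?thesis .
  qed
  with X(1) assms(2) show ?thesis by (intro ad_finI[of ?R]) auto
qed

text \<open>The representative picked by \<open>rep\<close> may have legs outside \<open>K\<close>.
  Bilinearity permits replacing it by one with all legs in \<open>K\<close>, where \<open>f\<close>
  and \<open>g\<close> agree.\<close>

lemma sweedler_cong_on:
  assumes "hopf_subalgebra K" "k \<in> K" "bilin f" "bilin g"
    and "\<And>a b. a \<in> K \<Longrightarrow> b \<in> K \<Longrightarrow> f a b = g a b"
  shows "sweedler k f = sweedler k g"
proof -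
  obtain x where x: "comult k = tensor2 scale x" "Poly_Mapping.keys x \<subseteq> K \<times> K"
    using assms(1,2) unfolding hopf_subalgebra_def tensor_of_def by blast
  show ?thesis
    unfolding x(1) tensor_eval_tensor2[OF assms(3)] tensor_eval_tensor2[OF assms(4)] linext_def
    using x(2) assms(5) by (intro sum.cong) auto
qed

lemma sweedler_flip:
  assumes "cocommutative_on K" "k \<in> K" "bilin f"
  shows "sweedler k f = sweedler k (\<lambda>a b. f b a)"
proof -
  have v: "vector_space scale" ..
  note comm = linear_linext_commute[OF linear_linext[OF v]]
  have "sweedler k f = tensor_eval scale f (tensor_flip scale (comult k))"
    using assms(1,2) by (simp add: cocommutative_on_def)
  also have "\<dots> = sweedler k (\<lambda>a b. f b a)"
    unfolding tensor_flip_def tensor_eval_tensor2[OF assms(3)]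
    by (simp add: comm case_prod_beta' linext_gen[OF v] tensor_eval_def)
  finally show ?thesis .
qed

section \<open>Consequences of cocommutativity of \<open>K\<close>\<close>

context
  fixes K
  assumes K: "hopf_subalgebra K" and cocomm: "cocommutative_on K"
begin

text \<open>Both sides are read off from \<open>S\<^sup>2(k\<^sub>1) S(k\<^sub>2) k\<^sub>3\<close>.\<close>

lemma antipode_antipode:
  assumes k: "k \<in> K"
  shows "antipode (antipode k) = k"
proof -
  let ?t = "\<lambda>a b c. antipode (antipode a) * antipode b * c"
  \<comment> \<open>After the flip the product is
    \<open>S(S(x\<^sub>2)) S(x\<^sub>1) = S(x\<^sub>1 S(x\<^sub>2))\<close>, to which the right
    antipode axiom applies.\<close>
  have left: "sweedler x (\<lambda>a b. ?t a b c) = scale (counit x) c" if "x \<in> K" for x c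
  proof -
    have "sweedler x (\<lambda>a b. ?t a b c) = sweedler x (\<lambda>b a. ?t a b c)"
      by (rule sweedler_flip[OF cocomm that]) (intro lin_rules)
    also have "\<dots> = scale (counit x) c"
      using sweedler_antipode_right[of "\<lambda>z. antipode z * c" x]
      by (simp add: antipode_mult antipode_one lin_rules)
    finally show ?thesis .
  qed
  have right: "sweedler x (\<lambda>b c. ?t a b c) = scale (counit x) (antipode (antipode a))" for x a
    using sweedler_antipode_left[of "\<lambda>z. antipode (antipode a) * z" x]
    by (simp add: mult.assoc lin_rules)
  have "antipode (antipode k) = sweedler k (\<lambda>a x. sweedler x (\<lambda>b c. ?t a b c))"
    unfolding right by (rule sweedler_counit_right[symmetric]; intro lin_rules)
  also have "\<dots> = sweedler k (\<lambda>x c. sweedler x (\<lambda>a b. ?t a b c))"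
    by (rule sweedler_assoc[symmetric]; intro lin_rules)
  also have "\<dots> = sweedler k (\<lambda>x c. scale (counit x) c)"
    by (rule sweedler_cong_on[OF K k]; (intro lin_rules)?) (rule left)
  also have "\<dots> = k"
    by (rule sweedler_counit_left; intro lin_rules)
  finally show ?thesis .
qed

text \<open>\<open>S(k\<^sub>1 h S(k\<^sub>2)) = S(S(k\<^sub>2)) S(h) S(k\<^sub>1)\<close>; flipping
  the legs and using \<open>antipode_antipode\<close> on \<open>K\<close> gives the adjoint action
  on \<open>S(h)\<close>.\<close>

lemma antipode_ad:
  assumes k: "k \<in> K"
  shows "antipode (ad k h) = ad k (antipode h)"
proof -
  have "antipode (ad k h) = sweedler k (\<lambda>a b. antipode (antipode b) * antipode h * antipode a)"
    unfolding ad_def lin_sweedler[OF antipode_linear] by (simp add: antipode_mult mult.assoc)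
  also have "\<dots> = sweedler k (\<lambda>b a. antipode (antipode b) * antipode h * antipode a)"
    by (rule sweedler_flip[OF cocomm k]) (intro lin_rules)
  also have "\<dots> = ad k (antipode h)"
    unfolding ad_def
    by (rule sweedler_cong_on[OF K k]; (intro lin_rules)?) (simp add: antipode_antipode)
  finally show ?thesis .
qed

text \<open>Flipping the two halves of the coproduct of \<open>k\<close> separately moves the inner
  factors to the left leg and the outer ones to the right leg.\<close>

lemma sweedler_ad_flip:
  assumes f: "bilin f" and k: "k \<in> K"
  shows "sweedler (ad k h) f = sweedler k (\<lambda>x y. sweedler x (\<lambda>p q. sweedler y (\<lambda>s t.
    sweedler h (\<lambda>a b. f (q * a * antipode s) (p * b * antipode t)))))"
proof -
  note rules = lin_rules lin_bilin_left[OF f] lin_bilin_right[OF f]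
  let ?t = "\<lambda>p q s t. sweedler h (\<lambda>a b. f (q * a * antipode s) (p * b * antipode t))"
  show ?thesis
    unfolding sweedler_ad[OF f]
  proof (rule sweedler_cong_on[OF K k]; (intro rules)?)
    fix x y assume x: "x \<in> K" and y: "y \<in> K"
    have "sweedler y (\<lambda>s t. ?t p q t s) = sweedler y (\<lambda>s t. ?t p q s t)" for p q
      by (rule sweedler_flip[OF cocomm y]) (intro rules)
    then have "sweedler x (\<lambda>p q. sweedler y (\<lambda>s t. ?t q p t s))
        = sweedler x (\<lambda>p q. sweedler y (\<lambda>s t. ?t q p s t))" by simp
    also have "\<dots> = sweedler x (\<lambda>p q. sweedler y (\<lambda>s t. ?t p q s t))"
      by (rule sweedler_flip[OF cocomm x]) (intro rules)
    finally show "sweedler x (\<lambda>p q. sweedler y (\<lambda>s t. ?t q p t s))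
        = sweedler x (\<lambda>p q. sweedler y (\<lambda>s t. ?t p q s t))" .
  qed
qed

lemma sweedler_ad_left_leg:
  assumes f: "bilin f" and k: "k \<in> K"
  shows "sweedler h (\<lambda>a b. f (ad k a) b)
    = sweedler k (\<lambda>u r. sweedler r (\<lambda>m w. sweedler (ad m h) (\<lambda>a b. f a (antipode u * b * w))))"
proof -
  note rules = lin_rules lin_ad_left lin_bilin_left[OF f] lin_bilin_right[OF f]
  let ?g = "\<lambda>x q s y. sweedler h (\<lambda>a b. f (q * a * antipode s) (x * b * y))"
  let ?t = "\<lambda>u m w. sweedler m (\<lambda>x y. sweedler x (\<lambda>p q. sweedler y (\<lambda>s t.
    ?g (antipode u * p) q s (antipode t * w))))"
  have eq: "sweedler (ad m h) (\<lambda>a b. f a (antipode u * b * w)) = ?t u m w" if "m \<in> K" for m u w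
    by (subst sweedler_ad_flip[OF _ that]) (simp_all add: rules mult.assoc)
  \<comment> \<open>The flipped formula is available only for \<open>m\<close> in \<open>K\<close>,
    so \<open>sweedler_cong_on\<close> is applied at each of the two nested coproducts.\<close>
  have "sweedler r (\<lambda>m w. sweedler (ad m h) (\<lambda>a b. f a (antipode u * b * w)))
      = sweedler r (\<lambda>m w. ?t u m w)" if "r \<in> K" for r u
    by (rule sweedler_cong_on[OF K that]; (intro rules)?) (rule eq)
  then have "sweedler k (\<lambda>u r. sweedler r (\<lambda>m w. sweedler (ad m h) (\<lambda>a b. f a (antipode u * b * w))))
      = sweedler k (\<lambda>u r. sweedler r (\<lambda>m w. ?t u m w))"
    by (intro sweedler_cong_on[OF K k]; (intro rules)?)
  also have "\<dots> = sweedler k (\<lambda>q s. ?g 1 q s 1)"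
    by (rule sweedler_conjugate_cancel; intro rules)
  also have "\<dots> = sweedler h (\<lambda>a b. sweedler k (\<lambda>q s. f (q * a * antipode s) b))"
    by (subst sweedler_swap) simp
  also have "\<dots> = sweedler h (\<lambda>a b. f (ad k a) b)"
    unfolding ad_def using lin_sweedler[of "\<lambda>x. f x b" for b] by (simp add: rules)
  finally show ?thesis by simp
qed

text \<open>The mirror image of \<open>ad_fin_right_slice\<close>. The identity for left legs holds
  for \<open>k\<close> in \<open>K\<close> only, and finite generation over \<open>K\<close> extends
  the bound to all of \<open>H\<close>.\<close>

lemma ad_fin_left_slice:
  assumes fg: "fin_gen_right_module K"
    and h: "h \<in> ad_fin" and \<phi>: "Vector_Spaces.linear scale (*) \<phi>"
  shows "sweedler h (\<lambda>a b. scale (\<phi> b) a) \<in> ad_fin"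
proof -
  note rules = lin_rules lin_functional[OF \<phi>]
  obtain B where B: "finite B" "\<And>k. ad k h \<in> span B" using h unfolding ad_fin_iff by blast
  let ?R = "\<Union>v\<in>B. fst ` Poly_Mapping.keys (rep (comult v))"
  have slice: "sweedler (ad m h) (\<lambda>a b. scale (\<phi> (u * b * w)) a) \<in> span ?R" for m u w
  proof (rule lin_image_span[OF _ B(2)])
    show "lin (\<lambda>v. sweedler v (\<lambda>a b. scale (\<phi> (u * b * w)) a))" by (intro rules)
    show "(\<lambda>v. sweedler v (\<lambda>a b. scale (\<phi> (u * b * w)) a)) ` B \<subseteq> span ?R"
      by (intro image_subsetI sweedler_in_subspace[OF subspace_span] span_scale span_base) force
  qed
  show ?thesis
  proof (rule ad_fin_if_fin_gen[OF fg])
    show "finite ?R" using B by auto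
    fix k assume k: "k \<in> K"
    have "ad k (sweedler h (\<lambda>a b. scale (\<phi> b) a)) = sweedler h (\<lambda>a b. scale (\<phi> b) (ad k a))"
      using lin_sweedler[OF ad_linear_right[of k]] ad_linear_right[of k]
      by (simp add: Vector_Spaces.linear_iff)
    also have "\<dots> \<in> span ?R"
      by (subst sweedler_ad_left_leg[OF _ k])
        (intro rules sweedler_in_subspace[OF subspace_span] slice)+
    finally show "ad k (sweedler h (\<lambda>a b. scale (\<phi> b) a)) \<in> span ?R" .
  qed
qed

text \<open>By \<open>antipode_ad\<close> the \<open>K\<close>-orbit of \<open>antipode h\<close> is
  the image under the antipode of that of \<open>h\<close>.\<close>

lemma antipode_in_ad_fin:
  assumes fg: "fin_gen_right_module K" and h: "h \<in> ad_fin"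
  shows "antipode h \<in> ad_fin"
proof -
  obtain B where B: "finite B" "\<And>k. ad k h \<in> span B" using h unfolding ad_fin_iff by blast
  show ?thesis
  proof (rule ad_fin_if_fin_gen[OF fg])
    show "finite (antipode ` B)" using B by simp
    show "ad k (antipode h) \<in> span (antipode ` B)" if "k \<in> K" for k
      unfolding antipode_ad[OF that, symmetric]
      by (rule lin_image_span[OF antipode_linear B(2)]) (auto intro: span_base)
  qed
qed

end

lemma hopf_subalgebra_ad_fin:
  assumes virtually_cocommutative
  shows "hopf_subalgebra ad_fin"
proof -
  obtain K where K: "hopf_subalgebra K" "cocommutative_on K" "fin_gen_right_module K"
    using assms unfolding virtually_cocommutative_def by blast
  show ?thesis
    unfolding hopf_subalgebra_def
    using subalgebra_ad_fin antipode_in_ad_fin[OF K]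
      comult_in_tensor_ofI[OF ad_fin_right_slice ad_fin_left_slice[OF K]] by blast
qed

end

theorem theorem1:
  fixes scale :: "'k::field \<Rightarrow> 'h::ring_1 \<Rightarrow> 'h"
    and comult :: "'h \<Rightarrow> ('h \<times> 'h \<Rightarrow>\<^sub>0 'k) set"
    and counit :: "'h \<Rightarrow> 'k"
    and antipode :: "'h \<Rightarrow> 'h"
  assumes "hopf_algebra scale comult counit antipode"
  shows "hopf_algebra.left_coideal_subalgebra scale comult
           (hopf_algebra.ad_fin scale comult antipode) \<and>
         (hopf_algebra.virtually_cocommutative scale comult antipode \<longrightarrow>
           hopf_algebra.hopf_subalgebra scale comult antipode
             (hopf_algebra.ad_fin scale comult antipode))"
  using hopf_algebra.left_coideal_subalgebra_ad_fin[OF assms]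
    hopf_algebra.hopf_subalgebra_ad_fin[OF assms] by blast

end
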